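(* Let $p$ be a prime, let $K$ be an algebraically closed field, and let $V\subset K^{n+2}$ be the simplicial toric variety attached to integers $d,a_1,\dots,a_n,b_1,\dots,b_n$ as described in the context. If $d=p^r$ for some nonnegative integer $r$, then $V$ is completely $p$-glued (and hence $V$ is a set-theoretic complete intersection if $\operatorname{char}K=p$).
   Context: Setting: $n$ is a positive integer, $d$ is a positive integer, and $a_1,\dots,a_n,b_1,\dots,b_n$ are nonnegative integers such that for every index $i$ at least one of $a_i,b_i$ is nonzero, and $\gcd(d,a_1,\dots,a_n,b_1,\dots,b_n)=1$. The variety $V\subset K^{n+2}$ (coordinates $x_1,\dots,x_n,y_1,y_2$) is the set of all points $$x_i=u_i^d\ (i=1,\dots,n),\qquad y_1=u_1^{a_1}u_2^{a_2}\cdots u_n^{a_n},\qquad y_2=u_1^{b_1}u_2^{b_2}\cdots u_n^{b_n},\qquad (u_1,\dots,u_n)\in K^n.$$ It has codimension 2. The subset of $\mathbb N^n$ attached to $V$ is $$T=\{(d,0,\dots,0),(0,d,0,\dots,0),\dots,(0,\dots,0,d),(a_1,\dots,a_n),(b_1,\dots,b_n)\}.$$ For a finite set $S\subset\mathbb N^n$, $\mathbb N S$ and $\mathbb Z S$ denote the semigroup (with zero) and the subgroup of $\mathbb Z^n$ generated by $S$. $p$-gluing: let $T_1,T_2$ be non-empty subsets of $T$ with $T=T_1\cup T_2$ and $T_1\cap T_2=\emptyset$. Then $T$ is called a $p$-gluing of $T_1$ and $T_2$ if there are an integer $k$ and a nonzero element $\mathbf w\in\mathbb Z^n$ such that $\mathbb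 Z T_1\cap\mathbb Z T_2=\mathbb Z\mathbf w$ and $p^k\mathbf w\in\mathbb N T_1\cap\mathbb N T_2$. Completely $p$-glued (recursive definition): an affine semigroup $\mathbb N T$ is called completely $p$-glued if $T$ is the $p$-gluing of $T_1$ and $T_2$, where each of the semigroups $\mathbb N T_1,\mathbb N T_2$ is completely $p$-glued or a free abelian semigroup. The variety $V$ is called completely $p$-glued if $\mathbb N T$ is. The arithmetical rank $\operatorname{ara}V$ of an affine variety $V\subset K^N$ is the minimum number of polynomial equations (over $K$) whose common zero set in $K^N$ is $V$; $V$ is a set-theoretic complete intersection if $\operatorname{ara}V=\operatorname{codim}V$ (here: if $\operatorname{ara}V=2$).
   Formalization: The claim that V is completely p-glued is stated except when both a and b lie in {0, d e_1, ..., d e_n} (then d = 1); there it is false, e.g. d=1, n=2, a=e_1, b=e_2, as T={e_1,e_2} admits no p-gluing. That V is a set-theoretic complete intersection is stated in all cases. *)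

theory Defs
  imports
    "HOL-Analysis.Analysis"
    "HOL-Computational_Algebra.Polynomial"
    "HOL-Computational_Algebra.Group_Closure"
    "HOL-Library.Poly_Mapping"
    "HOL-Library.Extended_Nat"
begin

section \<open>Affine semigroups and gluings\<close>

text \<open>
  \<open>\<nat>\<^sup>n\<close> is embedded in \<open>\<int>\<^sup>n\<close>. The group \<open>\<int> S\<close> is the library's \<^const>\<open>group_closure\<close>;
  the semigroup with zero \<open>\<nat> S\<close> consists of all finite sums, with repetitions, of elements of \<open>S\<close>.
\<close>

definition semigroup_gen :: "'a::comm_monoid_add set \<Rightarrow> 'a set" where
  "semigroup_gen S = sum_mset ` {X. set_mset X \<subseteq> S}"

text \<open>
  The finite multisets over \<open>B\<close> form the free commutative monoid on \<open>B\<close>, and \<^const>\<open>sum_mset\<close> is a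
  homomorphism from it. So a semigroup is free if this map is an isomorphism for some \<open>B\<close>.
\<close>

definition free_abelian_semigroup :: "'a::comm_monoid_add set \<Rightarrow> bool" where
  "free_abelian_semigroup M \<longleftrightarrow> (\<exists>B. bij_betw sum_mset {X. set_mset X \<subseteq> B} M)"

text \<open>
  A negative exponent \<open>k\<close> could never occur in a gluing: if \<open>p\<^sup>k w\<close> lies in
  \<open>\<nat> T\<^sub>1 \<inter> \<nat> T\<^sub>2 \<subseteq> \<int> w\<close> with \<open>w \<noteq> 0\<close>, then \<open>p\<^sup>k\<close> is an integer.
\<close>

definition p_gluing :: "nat \<Rightarrow> (int ^ 'n) set \<Rightarrow> (int ^ 'n) set \<Rightarrow> (int ^ 'n) set \<Rightarrow> bool" where
  "p_gluing p T T1 T2 \<longleftrightarrow>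
     T1 \<noteq> {} \<and> T2 \<noteq> {} \<and> T = T1 \<union> T2 \<and> T1 \<inter> T2 = {} \<and>
     (\<exists>(k::nat) w. w \<noteq> 0 \<and> group_closure T1 \<inter> group_closure T2 = group_closure {w} \<and>
        int p ^ k *s w \<in> semigroup_gen T1 \<inter> semigroup_gen T2)"

inductive completely_p_glued :: "nat \<Rightarrow> (int ^ 'n) set \<Rightarrow> bool" for p :: nat where
  "p_gluing p T T1 T2 \<Longrightarrow>
   completely_p_glued p T1 \<or> free_abelian_semigroup (semigroup_gen T1) \<Longrightarrow>
   completely_p_glued p T2 \<or> free_abelian_semigroup (semigroup_gen T2) \<Longrightarrow>
   completely_p_glued p T"


section \<open>Simplicial toric varieties of codimension two\<close>

definition int_vec :: "nat ^ 'n \<Rightarrow> int ^ 'n" where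
  "int_vec a = (\<chi> i. int (a $ i))"

text \<open>
  Pitfall: the generators form a set, so \<open>{axis i d | i} \<union> {a, b}\<close> may have fewer than \<open>n + 2\<close> elements.
  If \<open>a\<close> and \<open>b\<close> both lie in \<open>{0} \<union> {axis i d | i}\<close>, the nonzero generators are linearly
  independent, two disjoint subsets generate groups with intersection \<open>0\<close>, and no gluing exists.
\<close>

definition toric_generators :: "nat \<Rightarrow> nat ^ 'n \<Rightarrow> nat ^ 'n \<Rightarrow> (int ^ 'n) set" where
  "toric_generators d a b = range (\<lambda>i. axis i (int d)) \<union> {int_vec a, int_vec b}"

text \<open>
  \<open>K\<^sup>n\<^sup>+\<^sup>2\<close> is indexed by the sum type \<^typ>\<open>'n + 2\<close>: the coordinate \<open>x\<^sub>i\<close> has index \<open>Inl i\<close>,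
  and \<open>y\<^sub>1\<close>, \<open>y\<^sub>2\<close> have the indices \<open>Inr 1\<close>, \<open>Inr 2\<close> (in the two-element type \<open>2 = 0 \<noteq> 1\<close>).
\<close>

definition toric_point ::
  "nat \<Rightarrow> nat ^ 'n \<Rightarrow> nat ^ 'n \<Rightarrow> 'k::comm_semiring_1 ^ 'n \<Rightarrow> 'k ^ ('n + 2)" where
  "toric_point d a b u = (\<chi> v. case v of
       Inl i \<Rightarrow> u $ i ^ d
     | Inr j \<Rightarrow> if j = 1 then (\<Prod>i\<in>UNIV. u $ i ^ (a $ i)) else (\<Prod>i\<in>UNIV. u $ i ^ (b $ i)))"

definition toric_variety ::
  "nat \<Rightarrow> nat ^ 'n \<Rightarrow> nat ^ 'n \<Rightarrow> ('k::comm_semiring_1 ^ ('n + 2)) set" where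
  "toric_variety d a b = range (toric_point d a b)"


section \<open>Arithmetical rank\<close>

text \<open>
  Polynomials over \<open>'k\<close> in variables indexed by \<open>'v\<close> are finitely supported maps from monomials
  (finitely supported exponent maps \<open>'v \<Rightarrow>\<^sub>0 nat\<close>) to coefficients.
\<close>

definition mpoly_eval :: "(('v \<Rightarrow>\<^sub>0 nat) \<Rightarrow>\<^sub>0 'k) \<Rightarrow> 'k::comm_semiring_1 ^ 'v \<Rightarrow> 'k" where
  "mpoly_eval f x =
     (\<Sum>m\<in>Poly_Mapping.keys f. Poly_Mapping.lookup f m * (\<Prod>v\<in>UNIV. x $ v ^ Poly_Mapping.lookup m v))"

definition zero_locus :: "(('v \<Rightarrow>\<^sub>0 nat) \<Rightarrow>\<^sub>0 'k) set \<Rightarrow> ('k::comm_semiring_1 ^ 'v) set" where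
  "zero_locus F = {x. \<forall>f\<in>F. mpoly_eval f x = 0}"

text \<open>The value is \<open>\<infinity>\<close> if \<open>V\<close> is not an algebraic set.\<close>

definition ara :: "('k::comm_semiring_1 ^ 'v) set \<Rightarrow> enat" where
  "ara V = Inf {enat (card F) | F. finite F \<and> zero_locus F = V}"

end

theory Submission
  imports Defs
begin

text \<open>
  Gluing: write the generators as \<open>T \<union> {c}\<close> with \<open>d e\<^sub>i \<in> T\<close> for all \<open>i\<close>. The integers \<open>k\<close> with
  \<open>k c \<in> \<int> T\<close> form a subgroup \<open>\<int> m\<close> that contains \<open>d = p\<^sup>r\<close>, so \<open>m\<close> is a power of \<open>p\<close>, and the multiple
  \<open>d c\<close> of \<open>w = m c\<close> is a sum of the vectors \<open>d e\<^sub>i\<close>. So \<open>a\<close> and \<open>b\<close> can be glued one after the other to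
  the free semigroup generated by the \<open>d e\<^sub>i\<close>.

  Arithmetical rank: in characteristic \<open>p\<close> the map \<open>t \<mapsto> t\<^sup>d\<close> is a bijection of \<open>K\<close>, so \<open>V\<close> is cut out by
  \<open>y\<^sub>1\<^sup>d = x\<^sup>a\<close> and \<open>y\<^sub>2\<^sup>d = x\<^sup>b\<close>. It is the graph of a function of \<open>x\<close>, hence meets the plane
  \<open>x = (1,\<dots>,1)\<close> in a single point, which is impossible for the zero set of one polynomial.
\<close>

section \<open>Gluing\<close>

lemma semigroup_gen_zero: "0 \<in> semigroup_gen S"
  unfolding semigroup_gen_def by (rule image_eqI[of _ _ "{#}"]) auto

lemma semigroup_gen_base: "s \<in> S \<Longrightarrow> s \<in> semigroup_gen S"
  unfolding semigroup_gen_def by (rule image_eqI[of _ _ "{#s#}"]) auto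

lemma semigroup_gen_add:
  assumes "s \<in> semigroup_gen S" "t \<in> semigroup_gen S"
  shows "s + t \<in> semigroup_gen S"
proof -
  from assms obtain X Y where "set_mset X \<subseteq> S" "s = sum_mset X" "set_mset Y \<subseteq> S" "t = sum_mset Y"
    unfolding semigroup_gen_def by auto
  then show ?thesis
    unfolding semigroup_gen_def by (intro image_eqI[of _ _ "X + Y"]) auto
qed

lemma semigroup_gen_mono: "S \<subseteq> T \<Longrightarrow> semigroup_gen S \<subseteq> semigroup_gen T"
  unfolding semigroup_gen_def by auto

text \<open>Freeness refers to the semigroup and not to its generators, so this keeps the axes with
  0 adjoined free when \<open>int_vec b = 0\<close>.\<close>

lemma semigroup_gen_insert_zero: "semigroup_gen (insert 0 S) = semigroup_gen S"
proof
  have "sum_mset X \<in> semigroup_gen S" if "set_mset X \<subseteq> insert 0 S" for X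
    using that
    by (induction X) (auto simp: semigroup_gen_zero intro: semigroup_gen_add semigroup_gen_base)
  then show "semigroup_gen (insert 0 S) \<subseteq> semigroup_gen S"
    by (auto simp: semigroup_gen_def[of "insert 0 S"])
  show "semigroup_gen S \<subseteq> semigroup_gen (insert 0 S)"
    by (rule semigroup_gen_mono) auto
qed

lemma semigroup_gen_sum:
  assumes "\<And>i. i \<in> I \<Longrightarrow> f i \<in> semigroup_gen S"
  shows "sum f I \<in> semigroup_gen S"
  using assms
  by (induction I rule: infinite_finite_induct) (auto simp: semigroup_gen_zero intro: semigroup_gen_add)

lemma semigroup_gen_scale:
  fixes S :: "(int ^ 'n) set"
  assumes "s \<in> semigroup_gen S"
  shows "int k *s s \<in> semigroup_gen S"
  by (induction k)
    (use assms in \<open>auto simp: semigroup_gen_zero vector_sadd_rdistrib intro: semigroup_gen_add\<close>)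

lemma semigroup_gen_subset_group_closure: "semigroup_gen S \<subseteq> group_closure S"
proof -
  have "sum_mset X \<in> group_closure S" if "set_mset X \<subseteq> S" for X
    using that by (induction X) (auto intro: group_closure_add group_closure.base)
  then show ?thesis
    by (auto simp: semigroup_gen_def)
qed

lemma group_closure_scale:
  fixes S :: "(int ^ 'n) set"
  assumes "s \<in> group_closure S"
  shows "k *s s \<in> group_closure S"
proof -
  have nat: "int n *s s \<in> group_closure S" for n
    by (induction n) (use assms in \<open>auto simp: vector_sadd_rdistrib intro: group_closure_add\<close>)
  show ?thesis
  proof (cases "k \<ge> 0")
    case True
    then show ?thesis using nat[of "nat k"] by simp
  next
    case False
    then have "k *s s = - (int (nat (- k)) *s s)"
      by (simp add: vec_eq_iff)
    then show ?thesis using nat by (simp del: int_nat_eq)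
  qed
qed

lemma group_closure_singleton:
  fixes c :: "int ^ 'n"
  shows "group_closure {c} = range (\<lambda>k. k *s c)"
proof
  show "group_closure {c} \<subseteq> range (\<lambda>k. k *s c)"
  proof
    fix s assume "s \<in> group_closure {c}"
    then show "s \<in> range (\<lambda>k. k *s c)"
    proof induction
      case (base s)
      \<comment> \<open>The rule \<open>group_closure.base\<close> also covers 0, whence the first
        alternative.\<close>
      then have "s = 0 *s c \<or> s = 1 *s c" by auto
      then show ?case by blast
    next
      case (diff s t)
      then obtain k l where "s = k *s c" "t = l *s c" by auto
      then have "s - t = (k - l) *s c" by (simp add: vec_eq_iff left_diff_distrib)
      then show ?case by blast
    qed
  qed
qed (auto intro: group_closure_scale group_closure.base)

text \<open>The admissible \<open>k\<close> are closed under subtraction, and a subgroup of the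
  integers consists of the multiples of its \<open>Gcd\<close>. The value \<open>m = 0\<close>
  stands for a trivial intersection.\<close>

lemma multiples_in_group_closure:
  fixes T :: "(int ^ 'n) set"
  obtains m where "m \<ge> 0" "\<And>k. k *s c \<in> group_closure T \<longleftrightarrow> m dvd k"
proof -
  define I where "I = {k. k *s c \<in> group_closure T}"
  have "k \<in> I" if "k \<in> group_closure I" for k
    using that
  proof induction
    case (base k)
    then show ?case by (auto simp: I_def)
  next
    case (diff k l)
    have "(k - l) *s c = k *s c - l *s c" by (simp add: vec_eq_iff left_diff_distrib)
    then show ?case using diff by (auto simp: I_def intro: group_closure.diff)
  qed
  then have "group_closure I = I"
    by (auto intro: group_closure.base)
  moreover have "k \<in> group_closure I \<longleftrightarrow> Gcd I dvd k" for k
    unfolding group_closure_eq by (auto simp: dvd_def)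
  ultimately have "k *s c \<in> group_closure T \<longleftrightarrow> Gcd I dvd k" for k
    unfolding I_def by blast
  then show thesis
    by (rule that[rotated]) simp
qed

section \<open>Gluing on a single vector\<close>

lemma p_gluing_insert:
  fixes T :: "(int ^ 'n) set"
  assumes "prime p" "T \<noteq> {}" "c \<notin> T" "c \<noteq> 0" "int (p ^ r) *s c \<in> semigroup_gen T"
  shows "p_gluing p (insert c T) T {c}"
proof -
  from multiples_in_group_closure[of c T] obtain m
    where m: "m \<ge> 0" "\<And>k. k *s c \<in> group_closure T \<longleftrightarrow> m dvd k" by metis
  have "int (p ^ r) *s c \<in> group_closure T"
    using assms(5) semigroup_gen_subset_group_closure by blast
  then have "nat m dvd p ^ r"
    using m by (simp add: nat_dvd_iff)
  then obtain s where s: "s \<le> r" "nat m = p ^ s"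
    using divides_primepow_nat[OF \<open>prime p\<close>] by auto
  \<comment> \<open>This is \<open>m *s c\<close>, the least multiple of \<open>c\<close> in the
    group of \<open>T\<close>. The exponent \<open>r - s\<close> in the gluing brings it back to
    \<open>p^r c\<close>, which lies in both semigroups.\<close>
  define w where "w = int (p ^ s) *s c"
  have m_eq: "m = int (p ^ s)"
    using s(2) m(1) by linarith
  have "p > 0" using \<open>prime p\<close> by (rule prime_gt_0_nat)
  have "w \<noteq> 0"
    using \<open>c \<noteq> 0\<close> \<open>p > 0\<close> by (auto simp: w_def vec_eq_iff)
  moreover have "group_closure T \<inter> group_closure {c} = group_closure {w}"
  proof -
    have "group_closure T \<inter> group_closure {c} = {k *s c | k. m dvd k}"
      using m(2) by (auto simp: group_closure_singleton)
    also have "\<dots> = range (\<lambda>k. (k * m) *s c)"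
      unfolding dvd_def by (auto simp: mult.commute)
    also have "\<dots> = range (\<lambda>k. k *s w)"
      by (simp only: w_def m_eq vector_smult_assoc)
    finally show ?thesis by (simp add: group_closure_singleton)
  qed
  moreover have "int p ^ (r - s) *s w = int (p ^ r) *s c"
    using s(1) by (simp add: w_def vector_smult_assoc flip: power_add)
  moreover have "int (p ^ r) *s c \<in> semigroup_gen {c}"
    by (intro semigroup_gen_scale semigroup_gen_base) simp
  ultimately show ?thesis
    using assms unfolding p_gluing_def by (auto intro!: exI[of _ "r - s"] exI[of _ w])
qed

text \<open>A nonzero coordinate of \<open>c\<close> recovers the size of a multiset from its sum,
  and over one element the size determines the multiset.\<close>

lemma free_abelian_semigroup_singleton:
  fixes c :: "int ^ 'n"
  assumes "c \<noteq> 0"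
  shows "free_abelian_semigroup (semigroup_gen {c})"
proof -
  obtain i where i: "c $ i \<noteq> 0" using assms by (auto simp: vec_eq_iff)
  have "inj_on sum_mset {X. set_mset X \<subseteq> {c}}"
  proof (rule inj_onI)
    fix X Y :: "(int ^ 'n) multiset"
    assume XY: "X \<in> {X. set_mset X \<subseteq> {c}}" "Y \<in> {X. set_mset X \<subseteq> {c}}" "sum_mset X = sum_mset Y"
    have sum: "sum_mset Z $ i = int (size Z) * c $ i" if "set_mset Z \<subseteq> {c}" for Z
      using that by (induction Z) (auto simp: algebra_simps)
    have "size X = size Y"
      using sum[of X] sum[of Y] XY i by auto
    moreover have "Z = replicate_mset (size Z) c" if "set_mset Z \<subseteq> {c}" for Z
      using that by (induction Z) auto
    ultimately show "X = Y"
      using XY by (metis mem_Collect_eq)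
  qed
  then show ?thesis
    unfolding free_abelian_semigroup_def semigroup_gen_def by (auto simp: bij_betw_def)
qed

text \<open>The sum determines every multiplicity: its coordinate \<open>i\<close> is
  \<open>d\<close> times the multiplicity of the \<open>i\<close>-th axis vector.\<close>

lemma free_abelian_semigroup_axes:
  assumes "d > 0"
  shows "free_abelian_semigroup (semigroup_gen (range (\<lambda>i :: 'n::finite. axis i (int d))))"
proof -
  let ?E = "range (\<lambda>i :: 'n. axis i (int d))"
  have sum: "sum_mset X $ i = int d * int (count X (axis i (int d)))" if "set_mset X \<subseteq> ?E" for X i
    using that
  proof (induction X)
    case (add x X)
    then obtain j where "x = axis j (int d)" by auto
    then show ?case
      using add assms by (auto simp: axis_eq_axis algebra_simps) (auto simp: axis_def)
  qed simp
  have "inj_on sum_mset {X. set_mset X \<subseteq> ?E}"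
  proof (rule inj_onI)
    fix X Y assume XY: "X \<in> {X. set_mset X \<subseteq> ?E}" "Y \<in> {X. set_mset X \<subseteq> ?E}" "sum_mset X = sum_mset Y"
    show "X = Y"
    proof (rule multiset_eqI)
      fix x
      show "count X x = count Y x"
      proof (cases "x \<in> ?E")
        case True
        then show ?thesis using sum[of X] sum[of Y] XY assms by auto
      next
        case False
        then have "x \<notin># X" "x \<notin># Y" using XY by auto
        then show ?thesis by (simp add: not_in_iff)
      qed
    qed
  qed
  then show ?thesis
    unfolding free_abelian_semigroup_def semigroup_gen_def by (auto simp: bij_betw_def)
qed

section \<open>Gluing \<open>a\<close> and \<open>b\<close> to the axes\<close>

lemma scale_int_vec_in_semigroup_gen:
  fixes a :: "nat ^ 'n"
  assumes "range (\<lambda>i. axis i (int d)) \<subseteq> T"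
  shows "int d *s int_vec a \<in> semigroup_gen T"
proof -
  have "int d *s int_vec a = (\<Sum>i\<in>UNIV. int (a $ i) *s axis i (int d))"
    by (simp add: vec_eq_iff int_vec_def axis_def if_distrib[where f = "(*) _"] mult.commute
        cong: if_cong)
  also have "\<dots> \<in> semigroup_gen T"
    using assms by (intro semigroup_gen_sum semigroup_gen_scale semigroup_gen_base) auto
  finally show ?thesis .
qed

text \<open>One storey of the tower: \<open>T\<close> may be the free base or already glued.
  Excluding \<open>insert 0 T\<close> makes the parts disjoint and the new singleton free.\<close>

lemma completely_p_glued_insert:
  fixes a :: "nat ^ 'n"
  assumes "prime p" and "range (\<lambda>i. axis i (int (p ^ r))) \<subseteq> T" and "int_vec a \<notin> insert 0 T"
    and "completely_p_glued p T \<or> free_abelian_semigroup (semigroup_gen T)"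
  shows "completely_p_glued p (insert (int_vec a) T)"
proof (rule completely_p_glued.intros)
  show "p_gluing p (insert (int_vec a) T) T {int_vec a}"
    using assms by (intro p_gluing_insert scale_int_vec_in_semigroup_gen) auto
  show "completely_p_glued p {int_vec a} \<or> free_abelian_semigroup (semigroup_gen {int_vec a})"
    using assms(3) by (auto intro: free_abelian_semigroup_singleton)
qed fact

lemma completely_p_glued_toric_generators:
  fixes a b :: "nat ^ 'n"
  assumes "prime p" and a: "int_vec a \<notin> {0} \<union> range (\<lambda>i. axis i (int (p ^ r)))"
  shows "completely_p_glued p (toric_generators (p ^ r) a b)"
proof -
  let ?E = "range (\<lambda>i :: 'n. axis i (int (p ^ r)))"
  have "p ^ r > 0" using \<open>prime p\<close> by (simp add: prime_gt_0_nat)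
  note free = free_abelian_semigroup_axes[OF this, where 'n = 'n]
  show ?thesis
  proof (cases "int_vec b \<in> insert 0 (insert (int_vec a) ?E)")
    case True
    \<comment> \<open>Here \<open>b\<close> is 0 or repeats a generator, so one gluing suffices. A
      zero generator is placed on the side of the axes.\<close>
    then have "toric_generators (p ^ r) a b =
        insert (int_vec a) (if int_vec b = 0 then insert 0 ?E else ?E)"
      by (auto simp: toric_generators_def)
    also have "completely_p_glued p \<dots>"
      using assms free by (intro completely_p_glued_insert[where r = r]) (auto simp: semigroup_gen_insert_zero)
    finally show ?thesis .
  next
    case False
    have "completely_p_glued p (insert (int_vec a) ?E)"
      using assms free by (intro completely_p_glued_insert[where r = r]) auto
    then have "completely_p_glued p (insert (int_vec b) (insert (int_vec a) ?E))"
      using assms False by (intro completely_p_glued_insert[where r = r]) auto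
    moreover have "toric_generators (p ^ r) a b = insert (int_vec b) (insert (int_vec a) ?E)"
      by (auto simp: toric_generators_def)
    ultimately show ?thesis by simp
  qed
qed


section \<open>Arithmetical rank\<close>

lemma mpoly_eval_superset:
  assumes "finite A" "Poly_Mapping.keys f \<subseteq> A"
  shows "mpoly_eval f x =
    (\<Sum>m\<in>A. Poly_Mapping.lookup f m * (\<Prod>v\<in>UNIV. x $ v ^ Poly_Mapping.lookup m v))"
  unfolding mpoly_eval_def using assms
  by (intro sum.mono_neutral_left) (auto simp: in_keys_iff)

lemma mpoly_eval_diff:
  fixes x :: "'k::comm_ring_1 ^ 'v"
  shows "mpoly_eval (f - g) x = mpoly_eval f x - mpoly_eval g x"
proof -
  let ?A = "Poly_Mapping.keys f \<union> Poly_Mapping.keys g"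
  have "Poly_Mapping.keys (f - g) \<subseteq> ?A" by (rule keys_diff)
  then show ?thesis
    by (simp add: mpoly_eval_superset[of ?A] lookup_minus left_diff_distrib sum_subtractf)
qed

lemma mpoly_eval_single:
  "mpoly_eval (Poly_Mapping.single m c) x = c * (\<Prod>v\<in>UNIV. x $ v ^ Poly_Mapping.lookup m v)"
  by (subst mpoly_eval_superset[of "{m}"]) auto

text \<open>Freezing all variables except \<open>v\<close> leaves a univariate polynomial:
  substitute the indeterminate \<open>[:0, 1:]\<close> for \<open>v\<close> and constants
  elsewhere.\<close>

lemma mpoly_eval_coordinate_poly:
  fixes f :: "('v::finite \<Rightarrow>\<^sub>0 nat) \<Rightarrow>\<^sub>0 'k::comm_ring_1"
  obtains q where "\<And>t. mpoly_eval f (\<chi> u. if u = v then t else x $ u) = poly q t"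
proof -
  define q where "q = (\<Sum>m\<in>Poly_Mapping.keys f. [:Poly_Mapping.lookup f m:] *
    (\<Prod>u\<in>UNIV. (if u = v then [:0, 1:] else [:x $ u:]) ^ Poly_Mapping.lookup m u))"
  have "mpoly_eval f (\<chi> u. if u = v then t else x $ u) = poly q t" for t
    unfolding mpoly_eval_def q_def poly_sum poly_mult poly_prod poly_power
    by (intro sum.cong arg_cong2[where f = "(*)"] prod.cong arg_cong2[where f = "(^)"]) auto
  then show thesis by (rule that)
qed

text \<open>Over a finite field, the product of all \<open>X - a\<close> plus 1 would be a
  nonconstant polynomial without roots.\<close>

lemma infinite_UNIV_alg_closed: "infinite (UNIV :: 'k::alg_closed_field set)"
proof
  assume fin: "finite (UNIV :: 'k set)"
  define q :: "'k poly" where "q = (\<Prod>a\<in>UNIV. [:- a, 1:])"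
  have "degree q = card (UNIV :: 'k set)"
    by (simp add: q_def degree_prod_sum_eq)
  then have "degree q > 0" using fin by (simp add: card_gt_0_iff)
  then have "degree (q + 1) > 0" by (subst degree_add_eq_left) auto
  then obtain x where "poly (q + 1) x = 0" using alg_closed_imp_poly_has_root by blast
  moreover have "poly q x = 0"
    using fin by (auto simp: q_def poly_prod)
  ultimately show False by simp
qed

lemma poly_rootless_const:
  fixes q :: "'k::alg_closed_field poly"
  assumes "\<And>t. poly q t \<noteq> 0"
  shows "poly q s = poly q t"
proof -
  have "degree q = 0" using alg_closed_imp_poly_has_root[of q] assms by blast
  then show ?thesis by (auto elim: degree_eq_zeroE)
qed

text \<open>On a line \<open>s \<noteq> s0\<close> of the plane \<open>f\<close> has no zero, so it
  is constant in \<open>t\<close>. Being polynomial in \<open>s\<close>, it is then constant in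
  \<open>t\<close> at \<open>s0\<close> as well, so the zero \<open>(s0, t0)\<close> spreads to the
  whole line \<open>s = s0\<close>.\<close>

lemma hypersurface_no_isolated_point_in_plane:
  fixes f :: "('v::finite \<Rightarrow>\<^sub>0 nat) \<Rightarrow>\<^sub>0 'k::alg_closed_field" and x :: "'k ^ 'v"
  assumes "v \<noteq> w"
    and zero: "\<And>s t. mpoly_eval f (\<chi> u. if u = v then s else if u = w then t else x $ u) = 0 \<longleftrightarrow>
      s = s0 \<and> t = t0"
  shows False
proof -
  define g where "g s t = mpoly_eval f (\<chi> u. if u = v then s else if u = w then t else x $ u)" for s t
  have poly1: "\<exists>q. \<forall>s. g s t = poly q s" for t
  proof -
    obtain q where
      "mpoly_eval f (\<chi> u. if u = v then s else (\<chi> u. if u = w then t else x $ u) $ u) = poly q s" for s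
      using mpoly_eval_coordinate_poly by blast
    then have "g s t = poly q s" for s by (simp add: g_def cong: if_cong)
    then show ?thesis by blast
  qed
  have poly2: "\<exists>q. \<forall>t. g s t = poly q t" for s
  proof -
    have eq: "(\<chi> u. if u = v then s else if u = w then t else x $ u) =
        (\<chi> u. if u = w then t else (\<chi> u. if u = v then s else x $ u) $ u)" for t
      using \<open>v \<noteq> w\<close> by (auto simp: vec_eq_iff)
    obtain q where
      "mpoly_eval f (\<chi> u. if u = w then t else (\<chi> u. if u = v then s else x $ u) $ u) = poly q t" for t
      using mpoly_eval_coordinate_poly by blast
    then have "g s t = poly q t" for t unfolding g_def eq .
    then show ?thesis by blast
  qed
  have const: "g s t = g s t0" if "s \<noteq> s0" for s t
  proof -
    obtain q where q: "\<And>t. g s t = poly q t" using poly2 by blast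
    have "poly q t \<noteq> 0" for t
      using zero[of s t] that q[of t] by (simp add: g_def)
    then show ?thesis using poly_rootless_const q by metis
  qed
  have "t = t0" for t
  proof -
    obtain q1 q2 where q: "\<And>s. g s t = poly q1 s" "\<And>s. g s t0 = poly q2 s" using poly1 by metis
    \<comment> \<open>The restrictions to the lines at heights \<open>t\<close> and
      \<open>t0\<close> agree at infinitely many points, hence also at \<open>s0\<close>.\<close>
    have "- {s0} \<subseteq> {s. poly (q1 - q2) s = 0}"
      using const[of _ t] q by auto
    moreover have "infinite (- {s0})"
      using infinite_UNIV_alg_closed by (simp add: Compl_eq_Diff_UNIV)
    ultimately have "q1 - q2 = 0"
      using poly_roots_finite finite_subset by metis
    then have "g s0 t = g s0 t0" using q by simp
    then show ?thesis using zero[of s0 t] zero[of s0 t0] by (simp add: g_def)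
  qed
  from this[of 0] this[of 1] show False by simp
qed

section \<open>The toric variety in characteristic \<open>p\<close>\<close>

lemma inj_power_CHAR:
  fixes x y :: "'k::field"
  assumes "prime CHAR('k)" "x ^ (CHAR('k) ^ r) = y ^ (CHAR('k) ^ r)"
  shows "x = y"
proof -
  \<comment> \<open>By additivity of Frobenius, equal powers leave a vanishing power of
    \<open>x - y\<close>.\<close>
  have "((x - y) + y) ^ (CHAR('k) ^ r) = (x - y) ^ (CHAR('k) ^ r) + y ^ (CHAR('k) ^ r)"
    by (rule freshmans_dream') (use assms in auto)
  then show ?thesis using assms(2) by simp
qed

text \<open>The binomial \<open>y_j^d - x^c\<close>. The exponent map of \<open>x^c\<close> has
  finite support because the index type is finite.\<close>

definition toric_equation ::
  "nat \<Rightarrow> nat ^ 'n \<Rightarrow> 2 \<Rightarrow> (('n::finite + 2 \<Rightarrow>\<^sub>0 nat) \<Rightarrow>\<^sub>0 'k::comm_ring_1)" where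
  "toric_equation d c j =
     Poly_Mapping.single (Poly_Mapping.single (Inr j) d) 1 -
     Poly_Mapping.single (Abs_poly_mapping (\<lambda>v. case v of Inl i \<Rightarrow> c $ i | Inr _ \<Rightarrow> 0)) 1"

lemma mpoly_eval_toric_equation:
  "mpoly_eval (toric_equation d c j) x = x $ Inr j ^ d - (\<Prod>i\<in>UNIV. x $ Inl i ^ (c $ i))"
proof -
  have "(\<Prod>v\<in>UNIV. x $ v ^ Poly_Mapping.lookup (Poly_Mapping.single (Inr j) d) v) =
      (\<Prod>v\<in>{Inr j}. x $ v ^ d)"
    by (intro prod.mono_neutral_cong_right) (auto simp: lookup_single)
  moreover have "(\<Prod>v\<in>UNIV. x $ v ^ (case v of Inl i \<Rightarrow> c $ i | Inr _ \<Rightarrow> 0)) =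
      (\<Prod>i\<in>UNIV. x $ Inl i ^ (c $ i))"
    by (simp add: prod.Plus flip: UNIV_Plus_UNIV)
  ultimately show ?thesis
    by (simp add: toric_equation_def mpoly_eval_diff mpoly_eval_single Abs_poly_mapping_inverse)
qed

lemma toric_variety_iff:
  fixes x :: "'k::alg_closed_field ^ ('n::finite + 2)"
  assumes "prime CHAR('k)" and d: "d = CHAR('k) ^ r"
  shows "x \<in> toric_variety d a b \<longleftrightarrow>
    x $ Inr 1 ^ d = (\<Prod>i\<in>UNIV. x $ Inl i ^ (a $ i)) \<and>
    x $ Inr 2 ^ d = (\<Prod>i\<in>UNIV. x $ Inl i ^ (b $ i))"
    (is "_ \<longleftrightarrow> ?eqs")
proof
  have pow: "(\<Prod>i\<in>UNIV. u $ i ^ (c $ i)) ^ d = (\<Prod>i\<in>UNIV. (u $ i ^ d) ^ (c $ i))"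
    for u :: "'k ^ 'n" and c
    by (simp add: prod_power_distrib mult.commute flip: power_mult)
  {
    assume "x \<in> toric_variety d a b"
    then show ?eqs
      by (auto simp: toric_variety_def toric_point_def pow)
  next
    assume eqs: ?eqs
    have "d > 0" using assms by (simp add: prime_gt_0_nat)
    then have "\<forall>i. \<exists>y. y ^ d = x $ Inl i" using nth_root_exists by blast
    then obtain u where u: "\<And>i. u i ^ d = x $ Inl i" by metis
    have "x $ v = toric_point d a b (\<chi> i. u i) $ v" for v
    proof (cases v)
      case (Inl i)
      then show ?thesis by (simp add: toric_point_def u)
    next
      case (Inr j)
      \<comment> \<open>The equations fix each \<open>y\<close> coordinate only up to its
        \<open>d\<close>-th power; injectivity of that power removes the ambiguity.\<close>
      have "x $ v ^ d = toric_point d a b (\<chi> i. u i) $ v ^ d"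
        using eqs exhaust_2[of j] pow[of "\<chi> i. u i"] by (auto simp: Inr toric_point_def u)
      then show ?thesis using inj_power_CHAR assms by metis
    qed
    then show "x \<in> toric_variety d a b"
      unfolding toric_variety_def by (auto simp: vec_eq_iff)
  }
qed

lemma zero_locus_toric_equations:
  assumes "prime CHAR('k::alg_closed_field)" "d = CHAR('k) ^ r"
  shows "zero_locus {toric_equation d a 1, toric_equation d b 2} =
    (toric_variety d a b :: ('k ^ ('n::finite + 2)) set)"
  by (auto simp: zero_locus_def mpoly_eval_toric_equation toric_variety_iff[OF assms])

lemma toric_variety_not_hypersurface:
  fixes f :: "('n::finite + 2 \<Rightarrow>\<^sub>0 nat) \<Rightarrow>\<^sub>0 'k::alg_closed_field"
  assumes "prime CHAR('k)" "d = CHAR('k) ^ r"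
  shows "zero_locus {f} \<noteq> toric_variety d a b"
proof
  assume eq: "zero_locus {f} = toric_variety d a b"
  have one: "t ^ d = 1 \<longleftrightarrow> t = 1" for t :: 'k
    using inj_power_CHAR[OF assms(1), of t r 1] assms(2) by auto
  show False
  \<comment> \<open>With all \<open>x\<close> coordinates 1 both monomials are 1, so the equations
    read \<open>s^d = 1\<close> and \<open>t^d = 1\<close>.\<close>
  proof (rule hypersurface_no_isolated_point_in_plane[of "Inr 1" "Inr 2" f "\<chi> u. 1" 1 1])
    fix s t :: 'k
    let ?x = "\<chi> u. if u = Inr 1 then s else if u = Inr 2 then t else (\<chi> u. 1) $ u"
    have "mpoly_eval f ?x = 0 \<longleftrightarrow> ?x \<in> toric_variety d a b"
      by (simp flip: eq add: zero_locus_def)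
    also have "\<dots> \<longleftrightarrow> s = 1 \<and> t = 1"
      by (simp add: toric_variety_iff[OF assms] one)
    finally show "mpoly_eval f ?x = 0 \<longleftrightarrow> s = 1 \<and> t = 1" .
  qed simp
qed

lemma ara_toric_variety:
  assumes "prime CHAR('k::alg_closed_field)" "d = CHAR('k) ^ r"
  shows "ara (toric_variety d a b :: ('k ^ ('n::finite + 2)) set) = 2"
proof (rule antisym)
  let ?V = "toric_variety d a b :: ('k ^ ('n + 2)) set"
  let ?F = "{toric_equation d a 1, toric_equation d b 2} :: (('n + 2 \<Rightarrow>\<^sub>0 nat) \<Rightarrow>\<^sub>0 'k) set"
  have "ara ?V \<le> enat (card ?F)"
    unfolding ara_def using zero_locus_toric_equations[OF assms]
    by (intro Inf_lower) blast
  also have "\<dots> \<le> enat 2"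
    using card_insert_le_m1[of 2 "{toric_equation d b 2}"] by simp
  finally show "ara ?V \<le> 2" by (simp add: numeral_eq_enat)
  have "card F \<ge> 2" if F: "finite F" "zero_locus F = ?V" for F
  proof (rule ccontr)
    assume "\<not> card F \<ge> 2"
    then have "card F = 0 \<or> card F = 1" by linarith
    then have "F = {} \<or> (\<exists>f. F = {f})" using F(1) by (auto simp: card_1_singleton_iff)
    \<comment> \<open>No equation cuts out the same set as the zero polynomial, so the case of one
      equation covers both.\<close>
    moreover have "zero_locus {} = zero_locus {0 :: ('n + 2 \<Rightarrow>\<^sub>0 nat) \<Rightarrow>\<^sub>0 'k}"
      by (simp add: zero_locus_def mpoly_eval_def)
    ultimately show False
      using F(2) toric_variety_not_hypersurface[OF assms] by metis
  qed
  then show "2 \<le> ara ?V"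
    unfolding ara_def by (intro Inf_greatest) (auto simp: numeral_eq_enat)
qed

theorem proposition2:
  fixes a b :: "nat ^ 'n" and d p r :: nat
  assumes "prime p"
    and "d > 0"
    and "\<And>i. a $ i \<noteq> 0 \<or> b $ i \<noteq> 0"
    and "Gcd ({d} \<union> range (($) a) \<union> range (($) b)) = 1"
    and "d = p ^ r"
  shows "(\<not> {int_vec a, int_vec b} \<subseteq> {0} \<union> range (\<lambda>i. axis i (int d)) \<longrightarrow>
            completely_p_glued p (toric_generators d a b)) \<and>
         (CHAR('k::alg_closed_field) = p \<longrightarrow>
            ara (toric_variety d a b :: ('k ^ ('n + 2)) set) = 2)"
proof (intro conjI impI)
  assume "\<not> {int_vec a, int_vec b} \<subseteq> {0} \<union> range (\<lambda>i. axis i (int d))"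
  then consider "int_vec a \<notin> {0} \<union> range (\<lambda>i. axis i (int d))"
    | "int_vec b \<notin> {0} \<union> range (\<lambda>i. axis i (int d))"
    by blast
  then show "completely_p_glued p (toric_generators d a b)"
  proof cases
    case 1
    then show ?thesis
      using completely_p_glued_toric_generators assms(1,5) by blast
  next
    case 2
    \<comment> \<open>The generating set is symmetric in \<open>a\<close> and \<open>b\<close>, so
      \<open>b\<close> can be glued first.\<close>
    then have "completely_p_glued p (toric_generators d b a)"
      using completely_p_glued_toric_generators assms(1,5) by blast
    then show ?thesis by (simp add: toric_generators_def insert_commute)
  qed
next
  assume "CHAR('k) = p"
  then show "ara (toric_variety d a b :: ('k ^ ('n + 2)) set) = 2"
    using ara_toric_variety[of d r a b] assms(1,5) by blast
qed

end
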